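(* For each $a\in\mathbb{D}$, the ideal $P_a=\ker(\mathrm{ev}_a)$ is a maximal ideal of $\mathcal{R}=\mathbb{Z}[i][[z]]\cap\mathcal{O}(\mathbb{D})$, with $\mathcal{R}/P_a\cong\mathbb{C}$.
   Context: $\mathbb{D}=\{z\in\mathbb{C}:|z|<1\}$ is the open unit disk and $\mathcal{O}(\mathbb{D})$ is the ring of holomorphic functions on $\mathbb{D}$. $\mathcal{R}=\mathbb{Z}[i][[z]]\cap\mathcal{O}(\mathbb{D})$ is the ring of holomorphic functions on $\mathbb{D}$ all of whose Taylor coefficients at $0$ are Gaussian integers. For $a\in\mathbb{D}$, $\mathrm{ev}_a:\mathcal{R}\to\mathbb{C}$ is the evaluation map $f\mapsto f(a)$.
   Formalization: The point a = 0 is excluded: there evaluation gives the constant Taylor coefficient, so R/P_0 is isomorphic to Z[i], which is not a field, and P_0 is not maximal; the claim is stated for all nonzero a in the disk. *)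

theory Defs
  imports "HOL-Complex_Analysis.Complex_Analysis" "HOL-Algebra.Algebraic_Closure_Type"
begin

definition gaussian_ints :: "complex set" where
  "gaussian_ints = {z. Re z \<in> \<int> \<and> Im z \<in> \<int>}"

abbreviation unit_disk :: "complex set" where
  "unit_disk \<equiv> ball 0 1"

text \<open>
  Functions on the disk are represented by extensional functions (with value
  \<open>undefined\<close> off the disk), so that equality of elements is equality on the disk.
\<close>

definition hol_disk_ring :: "(complex \<Rightarrow> complex) ring" where
  "hol_disk_ring =
     \<lparr> carrier = {f \<in> extensional unit_disk. f holomorphic_on unit_disk},
       monoid.mult = (\<lambda>f g. restrict (\<lambda>z. f z * g z) unit_disk),
       one = restrict (\<lambda>z. 1) unit_disk,
       ring.zero = restrict (\<lambda>z. 0) unit_disk,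
       add = (\<lambda>f g. restrict (\<lambda>z. f z + g z) unit_disk) \<rparr>"

definition gauss_hol_ring :: "(complex \<Rightarrow> complex) ring" where
  "gauss_hol_ring = hol_disk_ring
     \<lparr> carrier := {f \<in> carrier hol_disk_ring.
                    \<forall>n. fps_nth (fps_expansion f 0) n \<in> gaussian_ints} \<rparr>"

abbreviation complex_ring :: "complex ring" where
  "complex_ring \<equiv> ring_of_type_algebra"

definition ev :: "complex \<Rightarrow> (complex \<Rightarrow> complex) \<Rightarrow> complex" where
  "ev a f = f a"

text \<open>
  For \<open>a = 0\<close> evaluation returns the constant Taylor coefficient, so its image is the ring of
  Gaussian integers and \<open>ev_ideal 0\<close> is not maximal; statements about maximality need \<open>a \<noteq> 0\<close>.
\<close>

definition ev_ideal :: "complex \<Rightarrow> (complex \<Rightarrow> complex) set" where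
  "ev_ideal a = a_kernel gauss_hol_ring complex_ring (ev a)"

end

theory Submission
  imports Defs
begin

text \<open>
  Everything follows from the surjectivity of evaluation at \<open>a\<close>: the kernel of a ring homomorphism
  onto a field is maximal (\<open>maximalideal_kernel_if_onto_field\<close>), and the first isomorphism theorem
  identifies the quotient with the field.

  Surjectivity asks to write an arbitrary complex number \<open>w\<close> as \<open>\<Sum>n. c n * a ^ n\<close> with Gaussian
  integers \<open>c n\<close> whose power series converges on the whole disk. This is a digit expansion in the
  base \<open>1 / a\<close>, which has modulus greater than \<open>1\<close>: take for \<open>c 0\<close> a Gaussian integer within
  distance \<open>1\<close> of \<open>w\<close>, divide the error by \<open>a\<close>, and repeat. The remainders never exceed
  \<open>1 / norm a\<close> after the first step, so the digits are bounded; bounded coefficients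
  give a function holomorphic on the disk, and the error after \<open>n\<close> digits, being a bounded remainder
  times \<open>a ^ n\<close>, tends to \<open>0\<close> (\<open>digits_sums\<close>).
\<close>

section \<open>Digit expansions with Gaussian integer digits\<close>

definition gauss_round :: "complex \<Rightarrow> complex" where
  "gauss_round z = Complex (of_int (round (Re z))) (of_int (round (Im z)))"

lemma gauss_round_in_gaussian_ints: "gauss_round z \<in> gaussian_ints"
  by (simp add: gauss_round_def gaussian_ints_def)

lemma norm_diff_gauss_round_le: "norm (z - gauss_round z) \<le> 1"
proof -
  have "norm (z - gauss_round z) \<le> \<bar>Re (z - gauss_round z)\<bar> + \<bar>Im (z - gauss_round z)\<bar>"
    by (rule cmod_le)
  also have "\<dots> \<le> 1/2 + 1/2"
    using of_int_round_abs_le[of "Re z"] of_int_round_abs_le[of "Im z"]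
    by (intro add_mono) (simp_all add: gauss_round_def abs_minus_commute)
  finally show ?thesis by simp
qed

primrec remainder :: "complex \<Rightarrow> complex \<Rightarrow> nat \<Rightarrow> complex" where
  "remainder a w 0 = w"
| "remainder a w (Suc n) = (remainder a w n - gauss_round (remainder a w n)) / a"

definition digit :: "complex \<Rightarrow> complex \<Rightarrow> nat \<Rightarrow> complex" where
  "digit a w n = gauss_round (remainder a w n)"

lemma sum_digits_plus_remainder:
  assumes "a \<noteq> 0"
  shows "(\<Sum>k<n. digit a w k * a ^ k) + remainder a w n * a ^ n = w"
proof (induction n)
  case (Suc n)
  have "remainder a w (Suc n) * a ^ Suc n = (remainder a w n - digit a w n) * a ^ n"
    using assms by (simp add: digit_def)
  with Suc show ?case by (simp add: left_diff_distrib del: remainder.simps power_Suc)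
qed simp

text \<open>
  Every rounding error has norm at most \<open>1\<close>, so each remainder after the initial one, which is
  \<open>w\<close> itself, has norm at most \<open>1 / norm a\<close>, however large the remainder before it was.
\<close>

lemma norm_remainder_le: "norm (remainder a w n) \<le> max (norm w) (1 / norm a)"
proof (cases n)
  case (Suc m)
  have "norm (remainder a w n) \<le> 1 / norm a"
    using norm_diff_gauss_round_le[of "remainder a w m"]
    by (simp add: Suc norm_divide divide_right_mono)
  then show ?thesis by simp
qed simp

lemma norm_digit_le: "norm (digit a w n) \<le> max (norm w) (1 / norm a) + 1"
proof -
  let ?r = "remainder a w n"
  have "norm (digit a w n) \<le> norm ?r + norm (?r - digit a w n)"
    using norm_triangle_ineq4[of ?r "?r - digit a w n"] by simp
  also have "\<dots> \<le> max (norm w) (1 / norm a) + 1"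
    unfolding digit_def by (intro add_mono norm_remainder_le norm_diff_gauss_round_le)
  finally show ?thesis .
qed

lemma digits_sums:
  assumes "a \<noteq> 0" "norm a < 1"
  shows "(\<lambda>n. digit a w n * a ^ n) sums w"
proof -
  have "(\<lambda>n. remainder a w n * a ^ n) \<longlonglongrightarrow> 0"
  proof (rule Lim_null_comparison[OF always_eventually])
    show "\<forall>n. norm (remainder a w n * a ^ n) \<le> max (norm w) (1 / norm a) * norm a ^ n"
      by (auto simp: norm_mult norm_power intro!: mult_right_mono norm_remainder_le)
    show "(\<lambda>n. max (norm w) (1 / norm a) * norm a ^ n) \<longlonglongrightarrow> 0"
      using assms by (intro tendsto_mult_right_zero LIMSEQ_realpow_zero) auto
  qed
  then have "(\<lambda>n. w - remainder a w n * a ^ n) \<longlonglongrightarrow> w - 0"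
    by (intro tendsto_intros)
  moreover have "(\<Sum>k<n. digit a w k * a ^ k) = w - remainder a w n * a ^ n" for n
    using sum_digits_plus_remainder[OF assms(1), of w n] by (simp add: eq_diff_eq)
  ultimately show ?thesis by (simp add: sums_def)
qed

lemma fps_conv_radius_ge_1_if_bounded:
  fixes F :: "complex fps"
  assumes "\<And>n. norm (fps_nth F n) \<le> B"
  shows "fps_conv_radius F \<ge> 1"
  unfolding fps_conv_radius_def
proof (rule conv_radius_geI_ex')
  fix r :: real
  assume r: "0 < r" "ereal r < 1"
  show "summable (\<lambda>n. fps_nth F n * of_real r ^ n)"
  proof (rule summable_comparison_test')
    show "summable (\<lambda>n. B * r ^ n)"
      using r by (intro summable_mult summable_geometric) auto
    show "norm (fps_nth F n * of_real r ^ n) \<le> B * r ^ n" for n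
      using r assms by (auto simp: norm_mult norm_power intro!: mult_right_mono)
  qed
qed

section \<open>The ring of holomorphic functions with Gaussian integer Taylor coefficients\<close>

lemma gaussian_ints_closed:
  "0 \<in> gaussian_ints" "1 \<in> gaussian_ints"
  "x \<in> gaussian_ints \<Longrightarrow> - x \<in> gaussian_ints"
  "x \<in> gaussian_ints \<Longrightarrow> y \<in> gaussian_ints \<Longrightarrow> x + y \<in> gaussian_ints"
  "x \<in> gaussian_ints \<Longrightarrow> y \<in> gaussian_ints \<Longrightarrow> x * y \<in> gaussian_ints"
  by (auto simp: gaussian_ints_def)

lemma gaussian_ints_sum:
  "(\<And>i. i \<in> A \<Longrightarrow> f i \<in> gaussian_ints) \<Longrightarrow> sum f A \<in> gaussian_ints"
  by (induction A rule: infinite_finite_induct) (auto intro: gaussian_ints_closed)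

lemma gauss_hol_ring_simps:
  "f \<otimes>\<^bsub>gauss_hol_ring\<^esub> g = restrict (\<lambda>z. f z * g z) unit_disk"
  "f \<oplus>\<^bsub>gauss_hol_ring\<^esub> g = restrict (\<lambda>z. f z + g z) unit_disk"
  "\<one>\<^bsub>gauss_hol_ring\<^esub> = restrict (\<lambda>z. 1) unit_disk"
  "\<zero>\<^bsub>gauss_hol_ring\<^esub> = restrict (\<lambda>z. 0) unit_disk"
  by (simp_all add: gauss_hol_ring_def hol_disk_ring_def)

text \<open>
  Through the uniqueness of power series expansions, membership in the ring can be shown from any
  known expansion, without computing derivatives at \<open>0\<close>.
\<close>

lemma restrict_in_gauss_hol_ring:
  assumes "g holomorphic_on unit_disk" "g has_fps_expansion F"
    "\<And>n. fps_nth F n \<in> gaussian_ints"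
  shows "restrict g unit_disk \<in> carrier gauss_hol_ring"
proof -
  have "restrict g unit_disk holomorphic_on unit_disk"
    using assms(1) by (rule holomorphic_transform) auto
  moreover have "eventually (\<lambda>z. restrict g unit_disk z = g z) (nhds 0)"
    by (rule eventually_mono[OF eventually_nhds_in_open[of unit_disk]]) auto
  then have "restrict g unit_disk has_fps_expansion F"
    using assms(2) has_fps_expansion_cong[OF _ refl] by blast
  then have "fps_expansion (restrict g unit_disk) 0 = F"
    by (rule fps_expansion_eqI)
  ultimately show ?thesis
    using assms(3) by (simp add: gauss_hol_ring_def hol_disk_ring_def)
qed

lemma gauss_hol_ringE:
  assumes "f \<in> carrier gauss_hol_ring"
  obtains F where "f \<in> extensional unit_disk" "f holomorphic_on unit_disk"
    "f has_fps_expansion F" "\<And>n. fps_nth F n \<in> gaussian_ints"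
proof -
  have f: "f \<in> extensional unit_disk" "f holomorphic_on unit_disk"
    "\<And>n. fps_nth (fps_expansion f 0) n \<in> gaussian_ints"
    using assms by (auto simp: gauss_hol_ring_def hol_disk_ring_def)
  moreover have "f has_fps_expansion fps_expansion f 0"
    by (rule has_fps_expansion_fps_expansion[OF open_ball _ f(2)]) simp
  ultimately show ?thesis using that[of "fps_expansion f 0"] by blast
qed

lemma gauss_hol_ring_closed:
  shows "f \<in> carrier gauss_hol_ring \<Longrightarrow> g \<in> carrier gauss_hol_ring \<Longrightarrow>
      restrict (\<lambda>z. f z + g z) unit_disk \<in> carrier gauss_hol_ring"
    and "f \<in> carrier gauss_hol_ring \<Longrightarrow> g \<in> carrier gauss_hol_ring \<Longrightarrow>
      restrict (\<lambda>z. f z * g z) unit_disk \<in> carrier gauss_hol_ring"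
    and "f \<in> carrier gauss_hol_ring \<Longrightarrow> restrict (\<lambda>z. - f z) unit_disk \<in> carrier gauss_hol_ring"
    and "restrict (\<lambda>z. 1) unit_disk \<in> carrier gauss_hol_ring"
    and "restrict (\<lambda>z. 0) unit_disk \<in> carrier gauss_hol_ring"
proof -
  assume f: "f \<in> carrier gauss_hol_ring"
  then obtain F where F: "f holomorphic_on unit_disk" "f has_fps_expansion F"
    "\<And>n. fps_nth F n \<in> gaussian_ints" by (rule gauss_hol_ringE) blast
  show "restrict (\<lambda>z. - f z) unit_disk \<in> carrier gauss_hol_ring"
    using F by (intro restrict_in_gauss_hol_ring[where F = "- F"])
      (auto intro!: holomorphic_intros fps_expansion_intros gaussian_ints_closed)
  assume "g \<in> carrier gauss_hol_ring"
  then obtain G where G: "g holomorphic_on unit_disk" "g has_fps_expansion G"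
    "\<And>n. fps_nth G n \<in> gaussian_ints" by (rule gauss_hol_ringE) blast
  show "restrict (\<lambda>z. f z + g z) unit_disk \<in> carrier gauss_hol_ring"
    using F G by (intro restrict_in_gauss_hol_ring[where F = "F + G"])
      (auto intro!: holomorphic_intros fps_expansion_intros gaussian_ints_closed)
  show "restrict (\<lambda>z. f z * g z) unit_disk \<in> carrier gauss_hol_ring"
    using F G by (intro restrict_in_gauss_hol_ring[where F = "F * G"])
      (auto simp: fps_mult_nth
            intro!: holomorphic_intros fps_expansion_intros gaussian_ints_sum gaussian_ints_closed)
next
  show "restrict (\<lambda>z. 1) unit_disk \<in> carrier gauss_hol_ring"
    by (rule restrict_in_gauss_hol_ring[where F = 1])
      (auto intro!: holomorphic_intros fps_expansion_intros gaussian_ints_closed)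
  show "restrict (\<lambda>z. 0) unit_disk \<in> carrier gauss_hol_ring"
    by (rule restrict_in_gauss_hol_ring[where F = 0])
      (auto intro!: holomorphic_intros fps_expansion_intros gaussian_ints_closed)
qed

lemma ring_gauss_hol_ring: "ring gauss_hol_ring" (is "ring ?R")
proof -
  note pointwise = gauss_hol_ring_simps restrict_def fun_eq_iff
  have undef: "f z = undefined" if "f \<in> carrier ?R" "z \<notin> unit_disk" for f z
    using that by (auto elim!: gauss_hol_ringE intro: extensional_arb)
  have left_zero: "\<zero>\<^bsub>?R\<^esub> \<oplus>\<^bsub>?R\<^esub> f = f"
    and left_one: "\<one>\<^bsub>?R\<^esub> \<otimes>\<^bsub>?R\<^esub> f = f"
    and right_one: "f \<otimes>\<^bsub>?R\<^esub> \<one>\<^bsub>?R\<^esub> = f" if "f \<in> carrier ?R" for f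
    using undef[OF that] by (auto simp: pointwise)
  note closed = gauss_hol_ring_closed[folded gauss_hol_ring_simps]
  show ?thesis
  proof (rule ringI)
    show "abelian_group ?R"
    proof (rule abelian_groupI)
      fix f assume f: "f \<in> carrier ?R"
      show "\<exists>g\<in>carrier ?R. g \<oplus>\<^bsub>?R\<^esub> f = \<zero>\<^bsub>?R\<^esub>"
        by (rule bexI[OF _ gauss_hol_ring_closed(3)[OF f]]) (simp add: pointwise)
    next
      fix f g h
      show "(f \<oplus>\<^bsub>?R\<^esub> g) \<oplus>\<^bsub>?R\<^esub> h = f \<oplus>\<^bsub>?R\<^esub> (g \<oplus>\<^bsub>?R\<^esub> h)"
        by (simp add: pointwise)
      show "f \<oplus>\<^bsub>?R\<^esub> g = g \<oplus>\<^bsub>?R\<^esub> f"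
        by (simp add: pointwise add.commute)
    qed (rule closed left_zero; assumption?)+
    show "Group.monoid ?R"
    proof (rule monoidI)
      fix f g h
      show "(f \<otimes>\<^bsub>?R\<^esub> g) \<otimes>\<^bsub>?R\<^esub> h = f \<otimes>\<^bsub>?R\<^esub> (g \<otimes>\<^bsub>?R\<^esub> h)"
        by (simp add: pointwise)
    qed (rule closed left_one right_one; assumption?)+
  qed (simp_all add: pointwise distrib_left distrib_right)
qed

section \<open>Evaluation\<close>

text \<open>
  An ideal that properly contains the kernel contains an element with nonzero, hence invertible, image.
  By surjectivity that inverse lifts to the ring, which forces the ideal to contain \<open>\<one>\<close>.
\<close>

lemma (in ring_hom_ring) maximalideal_kernel_if_onto_field:
  assumes S: "field S" and onto: "h ` carrier R = carrier S"
  shows "maximalideal (a_kernel R S h) R"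
proof (rule maximalidealI[OF kernel_is_ideal])
  have in_kernel: "z \<in> a_kernel R S h \<longleftrightarrow> z \<in> carrier R \<and> h z = \<zero>\<^bsub>S\<^esub>" for z
    unfolding a_kernel_def' by blast
  have "\<one>\<^bsub>S\<^esub> \<noteq> \<zero>\<^bsub>S\<^esub>"
    using S by (simp add: domain.one_not_zero field_def)
  then have "\<one>\<^bsub>R\<^esub> \<notin> a_kernel R S h"
    unfolding in_kernel hom_one by blast
  then show "carrier R \<noteq> a_kernel R S h"
    using R.one_closed by blast
  fix J
  assume J: "ideal J R" "a_kernel R S h \<subseteq> J" "J \<subseteq> carrier R"
  interpret J: ideal J R by fact
  show "J = a_kernel R S h \<or> J = carrier R"
  proof (cases "J \<subseteq> a_kernel R S h")
    case False
    then obtain x where x: "x \<in> J" "x \<in> carrier R" "h x \<noteq> \<zero>\<^bsub>S\<^esub>"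
      using J(3) in_kernel by blast
    then have "h x \<in> Units S"
      using hom_closed unfolding field.field_Units[OF S] by blast
    then have "inv\<^bsub>S\<^esub> (h x) \<in> carrier S" and inv: "inv\<^bsub>S\<^esub> (h x) \<otimes>\<^bsub>S\<^esub> h x = \<one>\<^bsub>S\<^esub>"
      by (blast intro: S.Units_inv_closed S.Units_l_inv)+
    then obtain y where y: "y \<in> carrier R" "h y = inv\<^bsub>S\<^esub> (h x)"
      unfolding onto[symmetric] by (elim imageE) simp
    \<comment> \<open>Modulo the kernel \<open>y\<close> is an inverse of \<open>x\<close>, and \<open>J\<close> contains both the kernel and \<open>x\<close>.\<close>
    have "\<one>\<^bsub>R\<^esub> \<ominus>\<^bsub>R\<^esub> y \<otimes>\<^bsub>R\<^esub> x \<in> a_kernel R S h"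
      using x y inv by (simp add: in_kernel R.minus_eq S.r_neg)
    with J(2) have "\<one>\<^bsub>R\<^esub> \<ominus>\<^bsub>R\<^esub> y \<otimes>\<^bsub>R\<^esub> x \<in> J" by blast
    moreover have "y \<otimes>\<^bsub>R\<^esub> x \<in> J"
      using x y by (intro J.I_l_closed)
    ultimately have "(\<one>\<^bsub>R\<^esub> \<ominus>\<^bsub>R\<^esub> y \<otimes>\<^bsub>R\<^esub> x) \<oplus>\<^bsub>R\<^esub> y \<otimes>\<^bsub>R\<^esub> x \<in> J"
      by (rule J.a_closed)
    then have "\<one>\<^bsub>R\<^esub> \<in> J"
      using R.m_closed[OF y(1) x(2)]
      by (simp only: R.minus_eq R.a_assoc R.l_neg R.r_zero R.one_closed R.a_inv_closed)
    then show ?thesis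
      using J.one_imp_carrier by blast
  qed (use J(2) in blast)
qed

lemma ring_hom_ring_ev:
  assumes "a \<in> unit_disk"
  shows "ring_hom_ring gauss_hol_ring complex_ring (ev a)"
  using assms
  by (intro ring_hom_ringI ring_gauss_hol_ring ring_from_type_algebra)
    (auto simp: ev_def gauss_hol_ring_simps ring_of_type_algebra_def)

lemma ev_onto:
  assumes "a \<in> unit_disk" "a \<noteq> 0"
  shows "ev a ` carrier gauss_hol_ring = carrier complex_ring"
proof -
  have "w \<in> ev a ` carrier gauss_hol_ring" for w
  proof (rule image_eqI)
    define F where "F = Abs_fps (digit a w)"
    have R: "fps_conv_radius F \<ge> 1"
      by (rule fps_conv_radius_ge_1_if_bounded[where B = "max (norm w) (1 / norm a) + 1"])
        (simp only: F_def fps_nth_Abs_fps norm_digit_le)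
    show "restrict (eval_fps F) unit_disk \<in> carrier gauss_hol_ring"
    proof (rule restrict_in_gauss_hol_ring)
      have "ball (0::complex) 1 \<subseteq> eball 0 (fps_conv_radius F)"
        using R by (auto simp: in_eball_iff intro!: less_le_trans[OF _ R])
      then show "eval_fps F holomorphic_on unit_disk"
        by (rule holomorphic_on_eval_fps)
      show "eval_fps F has_fps_expansion F"
        using R by (intro eval_fps_has_fps_expansion) (auto intro: less_le_trans[of _ "1::ereal"])
      show "fps_nth F n \<in> gaussian_ints" for n
        by (simp add: F_def digit_def gauss_round_in_gaussian_ints)
    qed
    have "eval_fps F a = w"
      using digits_sums[of a w] assms by (simp add: F_def eval_fps_def sums_iff)
    then show "w = ev a (restrict (eval_fps F) unit_disk)"
      using assms by (simp add: ev_def)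
  qed
  then show ?thesis
    by (auto simp: ring_of_type_algebra_def)
qed

theorem proposition7p3:
  fixes a :: complex
  assumes "a \<in> unit_disk" and "a \<noteq> 0"
  shows "maximalideal (ev_ideal a) gauss_hol_ring \<and>
         gauss_hol_ring Quot ev_ideal a \<simeq> complex_ring"
proof -
  interpret ring_hom_ring gauss_hol_ring complex_ring "ev a"
    using assms(1) by (rule ring_hom_ring_ev)
  show ?thesis
    unfolding ev_ideal_def
    using maximalideal_kernel_if_onto_field[OF field_from_type_algebra] FactRing_iso
      ev_onto[OF assms] by blast
qed

end
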